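(* Let $N_c, N_l, N$ be positive integers with $N \le \min(N_c, N_l)$, let $\mathbf{F}_c \in \mathbb{R}^{N_c}$ and $\mathbf{F}_l \in \mathbb{R}^{N_l}$ be the feature vectors of two modalities, and let $\mathbf{F} = [\mathbf{F}_c; \mathbf{F}_l] \in \mathbb{R}^{N_c+N_l}$ be their concatenation. Let $\mathbf{F}_o = [\widetilde{\mathbf{F}}_c; \widetilde{\mathbf{F}}_l]$ be any outlier obtained from $\mathbf{F}$ by Feature Mixing with $N$ swapped dimensions (for any outcome of the random selection of dimensions). Then the deviation of $\mathbf{F}_o$ from $\mathbf{F}$ is bounded by $$\|\mathbf{F}_o - \mathbf{F}\|_2 \le \sqrt{2N}\cdot \delta, \qquad \text{where } \delta = \max_{1 \le i \le N_c,\ 1 \le j \le N_l} \left| \mathbf{F}_c^{(i)} - \mathbf{F}_l^{(j)} \right|.$$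
   Context: Notation: $\mathbf{v}^{(i)}$ denotes the $i$-th coordinate of a vector $\mathbf{v}$, $[\mathbf{u};\mathbf{v}]$ denotes concatenation, and $\|\cdot\|_2$ is the Euclidean norm. Feature Mixing with parameter $N$: given $\mathbf{F}_c \in \mathbb{R}^{N_c}$ and $\mathbf{F}_l \in \mathbb{R}^{N_l}$, choose at random (without replacement) a list of $N$ distinct indices $a_1,\dots,a_N \in \{1,\dots,N_c\}$ and, separately, a list of $N$ distinct indices $b_1,\dots,b_N \in \{1,\dots,N_l\}$. Define $\widetilde{\mathbf{F}}_c \in \mathbb{R}^{N_c}$ by $\widetilde{\mathbf{F}}_c^{(a_k)} = \mathbf{F}_l^{(b_k)}$ for $k=1,\dots,N$ and $\widetilde{\mathbf{F}}_c^{(i)} = \mathbf{F}_c^{(i)}$ for all other indices $i$. Define $\widetilde{\mathbf{F}}_l \in \mathbb{R}^{N_l}$ by $\widetilde{\mathbf{F}}_l^{(b_k)} = \mathbf{F}_c^{(a_k)}$ for $k=1,\dots,N$ and $\widetilde{\mathbf{F}}_l^{(j)} = \mathbf{F}_l^{(j)}$ for all other indices $j$. The output is $\mathbf{F}_o = [\widetilde{\mathbf{F}}_c; \widetilde{\mathbf{F}}_l]$. *)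

theory Defs
  imports "HOL-Analysis.Analysis"
begin

text \<open>
  Vectors in \<open>\<real>^N\<^sub>c\<close> and \<open>\<real>^N\<^sub>l\<close> have types \<open>real ^ 'c\<close> and \<open>real ^ 'l\<close>, so that
  \<open>N\<^sub>c = CARD('c)\<close> and \<open>N\<^sub>l = CARD('l)\<close>. The concatenation in \<open>\<real>^(N\<^sub>c + N\<^sub>l)\<close> is
  indexed by the disjoint sum of the two index types: the first block of
  coordinates is tagged \<open>Inl\<close>, the second \<open>Inr\<close>.
\<close>

definition vec_concat :: "real ^ 'm \<Rightarrow> real ^ 'n \<Rightarrow> real ^ ('m::finite + 'n::finite)"
  where "vec_concat u v = (\<chi> s. case s of Inl i \<Rightarrow> u $ i | Inr j \<Rightarrow> v $ j)"

text \<open>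
  For equally long index lists \<open>is\<close> (distinct) and \<open>js\<close>: the vector \<open>u\<close> with its
  coordinate \<open>is ! k\<close> overwritten by \<open>v $ (js ! k)\<close>, for every position \<open>k\<close>; see
  the two lemmas below.
\<close>

definition overwrite ::
    "'m list \<Rightarrow> 'n list \<Rightarrow> real ^ 'm \<Rightarrow> real ^ 'n \<Rightarrow> real ^ 'm::finite"
  where "overwrite is js u v =
    (\<chi> i. case map_of (zip is js) i of None \<Rightarrow> u $ i | Some j \<Rightarrow> v $ j)"

lemma overwrite_nth:
  assumes "distinct is" "length is = length js" "k < length is"
  shows "overwrite is js u v $ (is ! k) = v $ (js ! k)"
  using assms by (simp add: overwrite_def map_of_zip_nth)

lemma overwrite_other:
  assumes "length is = length js" "i \<notin> set is"
  shows "overwrite is js u v $ i = u $ i"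
proof -
  have "map_of (zip is js) i = None"
    using assms by (simp add: map_of_zip_is_None)
  then show ?thesis by (simp add: overwrite_def)
qed

text \<open>
  The set of all possible outputs of Feature Mixing, one for each outcome
  \<open>(as, bs)\<close> of the random selection of two lists of \<open>N\<close> distinct indices.
\<close>

definition feature_mixing ::
    "nat \<Rightarrow> real ^ 'c \<Rightarrow> real ^ 'l \<Rightarrow> (real ^ ('c::finite + 'l::finite)) set"
  where "feature_mixing N Fc Fl =
    {vec_concat (overwrite as bs Fc Fl) (overwrite bs as Fl Fc) | as bs.
       distinct as \<and> length as = N \<and> distinct bs \<and> length bs = N}"

end

theory Submission
  imports Defs
begin

text \<open>Mixing alters only the selected coordinates, \<open>N\<close> in each block, so the
  difference \<open>Fo - vec_concat Fc Fl\<close> vanishes off a set of \<open>2 * N\<close>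
  coordinates. An altered coordinate trades an entry of one modality for an entry of the other, so
  each entry of the difference is at most the maximum \<delta> in absolute value
  (\<open>abs_overwrite_diff_le\<close>). The squared norm is thus a sum of at most
  \<open>2 * N\<close> nonzero terms, each at most the square of \<delta>
  (\<open>norm_le_sqrt_card_support\<close>).\<close>

lemma norm_le_sqrt_card_support:
  fixes x :: "real ^ 'n"
  assumes zero: "\<And>i. i \<notin> S \<Longrightarrow> x $ i = 0" and bound: "\<And>i. \<bar>x $ i\<bar> \<le> d"
  shows "norm x \<le> sqrt (real (card S)) * d"
proof -
  have d: "0 \<le> d"
    \<comment> \<open>Any index serves: the index type is inhabited and \<open>d\<close> dominates
      an absolute value.\<close>
    using bound[of undefined] by linarith
  have "(\<Sum>i\<in>UNIV. (x $ i)\<^sup>2) = (\<Sum>i\<in>S. (x $ i)\<^sup>2)"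
    by (rule sum.mono_neutral_right) (auto simp: zero)
  also have "\<dots> \<le> (\<Sum>i\<in>S. d\<^sup>2)"
    by (rule sum_mono) (use bound d in \<open>simp add: abs_le_square_iff[symmetric]\<close>)
  also have "\<dots> = real (card S) * d\<^sup>2"
    by simp
  finally have "norm x \<le> sqrt (real (card S) * d\<^sup>2)"
    by (simp add: norm_vec_def L2_set_def)
  then show ?thesis
    using d by (simp add: real_sqrt_mult)
qed

text \<open>An overwritten coordinate becomes some \<open>v $ j\<close>, so its change is one of the
  bounded differences; every other coordinate changes by 0.\<close>

lemma abs_overwrite_diff_le:
  assumes "distinct is" "length is = length js" "\<And>i j. \<bar>u $ i - v $ j\<bar> \<le> d"
  shows "\<bar>overwrite is js u v $ i - u $ i\<bar> \<le> d"
proof (cases "i \<in> set is")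
  case True
  then obtain k where "k < length is" "i = is ! k"
    by (auto simp: in_set_conv_nth)
  then show ?thesis
    using assms by (simp add: overwrite_nth abs_minus_commute)
next
  case False
  have "0 \<le> d"
    using assms(3)[of undefined undefined] by linarith
  then show ?thesis
    using False assms(2) by (simp add: overwrite_other)
qed

theorem theorem2:
  fixes N :: nat
    and Fc :: "real ^ 'c::finite"
    and Fl :: "real ^ 'l::finite"
    and Fo :: "real ^ ('c + 'l)"
  assumes "N \<ge> 1"
    and "N \<le> min CARD('c) CARD('l)"
    and "Fo \<in> feature_mixing N Fc Fl"
  shows "norm (Fo - vec_concat Fc Fl)
    \<le> sqrt (2 * real N) * Max {\<bar>Fc $ i - Fl $ j\<bar> | i j. True}"
proof -
  define d where "d = Max {\<bar>Fc $ i - Fl $ j\<bar> | i j. True}"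
  \<comment> \<open>As the image of a finite type the set is finite, which \<open>Max_ge\<close>
    requires.\<close>
  have "{\<bar>Fc $ i - Fl $ j\<bar> | i j. True} = (\<lambda>(i, j). \<bar>Fc $ i - Fl $ j\<bar>) ` UNIV"
    by auto
  then have "finite {\<bar>Fc $ i - Fl $ j\<bar> | i j. True}"
    by simp
  then have d: "\<bar>Fc $ i - Fl $ j\<bar> \<le> d" for i j
    unfolding d_def by (rule Max_ge) auto
  \<comment> \<open>In the second block the two modalities swap roles.\<close>
  have d': "\<bar>Fl $ j - Fc $ i\<bar> \<le> d" for i j
    using d[of i j] by (simp add: abs_minus_commute)
  obtain as bs where Fo: "Fo = vec_concat (overwrite as bs Fc Fl) (overwrite bs as Fl Fc)"
    and as: "distinct as" "length as = N" and bs: "distinct bs" "length bs = N"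
    using assms(3) by (auto simp: feature_mixing_def)
  \<comment> \<open>The altered coordinates of both blocks. The tags keep the blocks disjoint, so
    the cardinalities add; distinctness makes each equal to \<open>N\<close>.\<close>
  define S where "S = set as <+> set bs"
  have "card S = 2 * N"
    using as bs by (simp add: S_def card_Plus distinct_card)
  moreover have "norm (Fo - vec_concat Fc Fl) \<le> sqrt (real (card S)) * d"
  proof (rule norm_le_sqrt_card_support)
    fix s assume "s \<notin> S"
    then show "(Fo - vec_concat Fc Fl) $ s = 0"
      using as bs by (cases s) (simp_all add: S_def Plus_def image_iff Fo vec_concat_def overwrite_other)
  next
    fix s
    show "\<bar>(Fo - vec_concat Fc Fl) $ s\<bar> \<le> d"
      using as bs d d' by (cases s) (simp_all add: Fo vec_concat_def abs_overwrite_diff_le)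
  qed
  ultimately show ?thesis
    by (simp add: d_def)
qed

end
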